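(* There exist Banach spaces $X$ and $Y$ such that the pair $(X,Y)$ has the compact perturbation property for minimum modulus (CPPm) but does not have the weak minimizing property (WmP).
   Context: For Banach spaces $X,Y$, $\mathcal{L}(X,Y)$ denotes the space of bounded linear operators from $X$ to $Y$, $\mathcal{K}(X,Y)$ the space of compact operators, and $S_X$ the unit sphere of $X$. The minimum modulus of $T\in\mathcal{L}(X,Y)$ is $m(T)=\inf\{\|Tx\|:x\in S_X\}$; $T$ attains its minimum modulus if $\|Tx\|=m(T)$ for some $x\in S_X$. A minimizing sequence for $T$ is a sequence $(x_n)_n$ in $S_X$ with $\|Tx_n\|\to m(T)$. The pair $(X,Y)$ has the weak minimizing property (WmP) if every $T\in\mathcal{L}(X,Y)$ that admits a non-weakly null minimizing sequence (i.e. one that does not converge weakly to $0$) attains its minimum modulus. The pair $(X,Y)$ has the compact perturbation property for minimum modulus (CPPm) if every $T\in\mathcal{L}(X,Y)$ that does not attain its minimum modulus satisfies $\sup_{K\in\mathcal{K}(X,Y)}m(T+K)=m(T)$. *)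

theory Defs
  imports "HOL-Analysis.Analysis" "HOL-Algebra.Module"
begin

text \<open>
  Banach spaces are treated as structures with an explicit carrier, because HOL cannot quantify
  existentially over types. A normed space is a module record over the real scalars extended by a
  norm. The fields \<open>mult\<close> and \<open>one\<close>, which \<open>HOL-Algebra\<close>'s module records inherit from rings, carry
  no meaning.
\<close>

record 'a normed_space = "(real, 'a) module" +
  nrm :: "'a \<Rightarrow> real"

definition real_scalars :: "real ring" where
  "real_scalars = \<lparr>carrier = UNIV, mult = (*), one = 1, zero = 0, add = (+)\<rparr>"

text \<open>The value outside the carrier is irrelevant; \<^locale>\<open>Metric_space\<close> needs symmetry and
  nonnegativity on the whole type.\<close>

definition nrm_dist :: "('a, 'm) normed_space_scheme \<Rightarrow> 'a \<Rightarrow> 'a \<Rightarrow> real" where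
  "nrm_dist X x y =
     (if x \<in> carrier X \<and> y \<in> carrier X then nrm X (x \<ominus>\<^bsub>X\<^esub> y) else 0)"

abbreviation nrm_topology :: "('a, 'm) normed_space_scheme \<Rightarrow> 'a topology" where
  "nrm_topology X \<equiv> Metric_space.mtopology (carrier X) (nrm_dist X)"

locale real_normed_space = module real_scalars X for X :: "('a, 'm) normed_space_scheme" (structure) +
  assumes nrm_eq_zero_iff: "x \<in> carrier X \<Longrightarrow> nrm X x = 0 \<longleftrightarrow> x = \<zero>"
    and nrm_triangle: "\<lbrakk>x \<in> carrier X; y \<in> carrier X\<rbrakk> \<Longrightarrow> nrm X (x \<oplus> y) \<le> nrm X x + nrm X y"
    and nrm_smult: "x \<in> carrier X \<Longrightarrow> nrm X (c \<odot> x) = \<bar>c\<bar> * nrm X x"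

locale real_banach_space = real_normed_space +
  assumes complete: "Metric_space.mcomplete (carrier X) (nrm_dist X)"

lemma (in real_normed_space) smult_minus_one:
  assumes "x \<in> carrier X"
  shows "(- 1) \<odot> x = \<ominus> x"
proof -
  have "\<ominus>\<^bsub>real_scalars\<^esub> 1 = - 1"
    using R.minus_equality[of "- 1" "1"] by (simp add: real_scalars_def)
  moreover have "1 \<odot> x = x"
    using smult_one[OF assms] by (simp add: real_scalars_def)
  ultimately show ?thesis
    using smult_l_minus[of 1 x] assms by (simp add: real_scalars_def)
qed

lemma (in real_normed_space) nrm_minus: "x \<in> carrier X \<Longrightarrow> nrm X (\<ominus> x) = nrm X x"
  using nrm_smult[of x "- 1"] smult_minus_one by simp

lemma (in real_normed_space) nrm_nonneg:
  assumes "x \<in> carrier X"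
  shows "0 \<le> nrm X x"
  using nrm_triangle[of x "\<ominus> x"] assms nrm_minus nrm_eq_zero_iff[of "\<zero>"] M.r_neg[of x] by simp

lemma (in real_normed_space) Metric_space_nrm_dist: "Metric_space (carrier X) (nrm_dist X)"
proof
  show "0 \<le> nrm_dist X x y" for x y
    by (simp add: nrm_dist_def nrm_nonneg)
  show "nrm_dist X x y = nrm_dist X y x" for x y
  proof (cases "x \<in> carrier X \<and> y \<in> carrier X")
    case True
    then have "\<ominus> (x \<ominus> y) = y \<ominus> x"
      by (simp add: a_minus_def M.minus_add M.a_comm)
    then show ?thesis
      using True nrm_minus[of "x \<ominus> y"] by (simp add: nrm_dist_def)
  qed (auto simp: nrm_dist_def)
  show "nrm_dist X x y = 0 \<longleftrightarrow> x = y" if "x \<in> carrier X" "y \<in> carrier X" for x y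
    using that M.minus_unique[of x "\<ominus> y" y]
    by (auto simp: nrm_dist_def nrm_eq_zero_iff a_minus_def M.r_neg M.l_neg
        dest: M.minus_equality)
  show "nrm_dist X x z \<le> nrm_dist X x y + nrm_dist X y z"
    if "x \<in> carrier X" "y \<in> carrier X" "z \<in> carrier X" for x y z
  proof -
    have "x \<ominus> z = (x \<ominus> y) \<oplus> (y \<ominus> z)"
      using that by (simp add: a_minus_def M.a_assoc M.r_neg1 M.r_neg2)
    then show ?thesis
      using that nrm_triangle[of "x \<ominus> y" "y \<ominus> z"] by (simp add: nrm_dist_def)
  qed
qed

text \<open>Operators are functions on the underlying types; their values outside the carrier of the
  domain play no role.\<close>

definition bounded_operators ::
    "('a, 'm) normed_space_scheme \<Rightarrow> ('b, 'n) normed_space_scheme \<Rightarrow> ('a \<Rightarrow> 'b) set" where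
  "bounded_operators X Y =
     {T \<in> carrier X \<rightarrow> carrier Y.
        (\<forall>x\<in>carrier X. \<forall>y\<in>carrier X. T (x \<oplus>\<^bsub>X\<^esub> y) = T x \<oplus>\<^bsub>Y\<^esub> T y) \<and>
        (\<forall>c. \<forall>x\<in>carrier X. T (c \<odot>\<^bsub>X\<^esub> x) = c \<odot>\<^bsub>Y\<^esub> T x) \<and>
        (\<exists>C. \<forall>x\<in>carrier X. nrm Y (T x) \<le> C * nrm X x)}"

definition compact_operators ::
    "('a, 'm) normed_space_scheme \<Rightarrow> ('b, 'n) normed_space_scheme \<Rightarrow> ('a \<Rightarrow> 'b) set" where
  "compact_operators X Y =
     {K \<in> bounded_operators X Y.
        compactin (nrm_topology Y)
          (nrm_topology Y closure_of (K ` {x \<in> carrier X. nrm X x \<le> 1}))}"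

definition unit_sphere :: "('a, 'm) normed_space_scheme \<Rightarrow> 'a set" where
  "unit_sphere X = {x \<in> carrier X. nrm X x = 1}"

text \<open>Infima and suprema are taken in the extended reals, so that they are the genuine ones even
  for the empty sphere of the zero space and for unbounded families.\<close>

definition min_modulus ::
    "('a, 'm) normed_space_scheme \<Rightarrow> ('b, 'n) normed_space_scheme \<Rightarrow> ('a \<Rightarrow> 'b) \<Rightarrow> ereal" where
  "min_modulus X Y T = (INF x\<in>unit_sphere X. ereal (nrm Y (T x)))"

definition attains_min_modulus ::
    "('a, 'm) normed_space_scheme \<Rightarrow> ('b, 'n) normed_space_scheme \<Rightarrow> ('a \<Rightarrow> 'b) \<Rightarrow> bool" where
  "attains_min_modulus X Y T \<longleftrightarrow> (\<exists>x\<in>unit_sphere X. ereal (nrm Y (T x)) = min_modulus X Y T)"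

definition minimizing_sequence ::
    "('a, 'm) normed_space_scheme \<Rightarrow> ('b, 'n) normed_space_scheme \<Rightarrow> ('a \<Rightarrow> 'b) \<Rightarrow> (nat \<Rightarrow> 'a) \<Rightarrow> bool" where
  "minimizing_sequence X Y T x \<longleftrightarrow>
     (\<forall>n. x n \<in> unit_sphere X) \<and> (\<lambda>n. ereal (nrm Y (T (x n)))) \<longlonglongrightarrow> min_modulus X Y T"

definition real_line :: "real normed_space" where
  "real_line = \<lparr>carrier = UNIV, mult = (*), one = 1, zero = 0, add = (+), smult = (*), nrm = abs\<rparr>"

definition weakly_null :: "('a, 'm) normed_space_scheme \<Rightarrow> (nat \<Rightarrow> 'a) \<Rightarrow> bool" where
  "weakly_null X x \<longleftrightarrow> (\<forall>\<phi>\<in>bounded_operators X real_line. (\<lambda>n. \<phi> (x n)) \<longlonglongrightarrow> 0)"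

definition weak_minimizing_property ::
    "('a, 'm) normed_space_scheme \<Rightarrow> ('b, 'n) normed_space_scheme \<Rightarrow> bool" where
  "weak_minimizing_property X Y \<longleftrightarrow>
     (\<forall>T\<in>bounded_operators X Y.
        (\<exists>x. minimizing_sequence X Y T x \<and> \<not> weakly_null X x) \<longrightarrow> attains_min_modulus X Y T)"

definition compact_perturbation_property_min ::
    "('a, 'm) normed_space_scheme \<Rightarrow> ('b, 'n) normed_space_scheme \<Rightarrow> bool" where
  "compact_perturbation_property_min X Y \<longleftrightarrow>
     (\<forall>T\<in>bounded_operators X Y. \<not> attains_min_modulus X Y T \<longrightarrow>
        (SUP K\<in>compact_operators X Y. min_modulus X Y (\<lambda>x. T x \<oplus>\<^bsub>Y\<^esub> K x)) = min_modulus X Y T)"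

end

(* Take X = l1 and Y = l2. For a bounded T from l1 to l2, the parallelogram law lets one choose signs
   such that the norm of T (\<plusminus>e_0 \<plusminus> ... \<plusminus> e_{n-1}) is at most C * sqrt n, while the
   argument has l1-norm n; hence m(T) = 0 for every T, and CPPm holds trivially. The injective
   operator e_n \<mapsto> e_n / (n + 1) does not attain its minimum modulus 0, although the unit
   vectors, which are not weakly null in l1, minimize it. *)

theory Submission
  imports Defs
begin

section \<open>Sequence spaces normed by a supremum of seminorms\<close>

text \<open>Both l1 and l2 consist of the sequences whose truncations to the first \<open>k\<close>
  coordinates have bounded norm, normed by the supremum over \<open>k\<close>. Taking the seminorms
  \<open>p k\<close> as a parameter lets one construction and one completeness proof serve both
  spaces.\<close>

definition seq_space :: "(nat \<Rightarrow> (nat \<Rightarrow> real) \<Rightarrow> real) \<Rightarrow> (nat \<Rightarrow> real) normed_space" where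
  "seq_space p = \<lparr>carrier = {x. bdd_above (range (\<lambda>k. p k x))}, mult = (\<lambda>x y. x), one = (\<lambda>i. 0),
     zero = (\<lambda>i. 0), add = (\<lambda>x y i. x i + y i), smult = (\<lambda>c x i. c * x i),
     nrm = (\<lambda>x. SUP k. p k x)\<rparr>"

lemma seq_space_simps [simp]:
  "zero (seq_space p) = (\<lambda>i. 0)"
  "add (seq_space p) x y = (\<lambda>i. x i + y i)"
  "smult (seq_space p) c x = (\<lambda>i. c * x i)"
  by (simp_all add: seq_space_def)

lemma real_scalars_simps [simp]:
  "carrier real_scalars = UNIV" "mult real_scalars = (*)" "one real_scalars = 1"
  "zero real_scalars = 0" "add real_scalars = (+)"
  by (simp_all add: real_scalars_def)

lemma cring_real_scalars: "cring real_scalars"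
proof (rule cringI)
  show "abelian_group real_scalars"
    by (rule abelian_groupI) (auto intro: exI[of _ "- x" for x :: real])
  show "comm_monoid real_scalars"
    by (rule comm_monoidI) auto
qed (auto simp: algebra_simps)

text \<open>\<open>coordinate_le\<close> makes the norm definite and turns Cauchy in norm into
  Cauchy in each coordinate; \<open>pointwise_continuous\<close> lets bounds on a single
  \<open>p k\<close> pass to coordinatewise limits. In the instances \<open>p k\<close> sees only
  the coordinates below \<open>k\<close>, so coordinate \<open>i\<close> first appears in
  \<open>p (Suc i)\<close>.\<close>

locale seminorm_sequence =
  fixes p :: "nat \<Rightarrow> (nat \<Rightarrow> real) \<Rightarrow> real"
  assumes triangle: "p k (\<lambda>i. x i + y i) \<le> p k x + p k y"
    and scale: "p k (\<lambda>i. c * x i) = \<bar>c\<bar> * p k x"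
    and coordinate_le: "\<bar>x i\<bar> \<le> p (Suc i) x"
    and pointwise_continuous:
      "(\<And>i. (\<lambda>n. f n i) \<longlonglongrightarrow> g i) \<Longrightarrow> (\<lambda>n. p k (f n)) \<longlonglongrightarrow> p k g"
begin

abbreviation "E \<equiv> seq_space p"

lemma p_zero: "p k (\<lambda>i. 0) = 0"
  using scale[of k 0 "\<lambda>i. 0"] by simp

lemma p_le_nrm: "x \<in> carrier E \<Longrightarrow> p k x \<le> nrm E x"
  by (auto simp: seq_space_def intro: cSUP_upper)

lemma nrm_le: "(\<And>k. p k x \<le> C) \<Longrightarrow> nrm E x \<le> C"
  by (auto simp: seq_space_def intro: cSUP_least)

lemma carrierI: "(\<And>k. p k x \<le> C) \<Longrightarrow> x \<in> carrier E"
  by (auto simp: seq_space_def intro!: bdd_aboveI)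

lemma add_carrier:
  assumes "x \<in> carrier E" "y \<in> carrier E"
  shows "(\<lambda>i. x i + y i) \<in> carrier E"
proof (rule carrierI)
  show "p k (\<lambda>i. x i + y i) \<le> nrm E x + nrm E y" for k
    using triangle[of k x y] p_le_nrm[OF assms(1), of k] p_le_nrm[OF assms(2), of k] by linarith
qed

lemma p_scale_le: "x \<in> carrier E \<Longrightarrow> p k (\<lambda>i. c * x i) \<le> \<bar>c\<bar> * nrm E x"
  by (simp add: scale mult_left_mono p_le_nrm)

lemma scale_carrier: "x \<in> carrier E \<Longrightarrow> (\<lambda>i. c * x i) \<in> carrier E"
  by (rule carrierI, rule p_scale_le)

lemma zero_carrier: "(\<lambda>i. 0) \<in> carrier E"
  by (rule carrierI[of _ 0]) (simp add: p_zero)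

lemma nrm_zero: "nrm E (\<lambda>i. 0) = 0"
  by (simp add: seq_space_def p_zero)

lemma coordinate_le_nrm: "x \<in> carrier E \<Longrightarrow> \<bar>x i\<bar> \<le> nrm E x"
  using coordinate_le p_le_nrm order_trans by blast

lemma nrm_scale:
  assumes "x \<in> carrier E"
  shows "nrm E (\<lambda>i. c * x i) = \<bar>c\<bar> * nrm E x"
proof (cases "c = 0")
  case False
  have le: "nrm E (\<lambda>i. d * y i) \<le> \<bar>d\<bar> * nrm E y" if "y \<in> carrier E" for d y
    using that by (intro nrm_le p_scale_le)
  \<comment> \<open>The reverse inequality is the same bound \<open>le\<close>, applied to the
    scaled sequence and the factor \<open>inverse c\<close>.\<close>
  have "nrm E x \<le> \<bar>inverse c\<bar> * nrm E (\<lambda>i. c * x i)"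
    using le[OF scale_carrier[OF assms], of "inverse c" c] False
    by (simp add: mult.assoc[symmetric])
  then have "\<bar>c\<bar> * nrm E x \<le> nrm E (\<lambda>i. c * x i)"
    using False by (simp add: field_simps)
  then show ?thesis
    using le[OF assms, of c] by linarith
qed (simp add: nrm_zero)

lemma abelian_group_seq_space: "abelian_group E"
proof (rule abelian_groupI)
  show "\<exists>y\<in>carrier E. y \<oplus>\<^bsub>E\<^esub> x = \<zero>\<^bsub>E\<^esub>" if "x \<in> carrier E" for x
    using scale_carrier[OF that, of "- 1"] by (intro bexI[of _ "\<lambda>i. - 1 * x i"]) auto
qed (auto simp: add_carrier zero_carrier algebra_simps)

lemma module_seq_space: "module real_scalars E"
  by (rule moduleI)
    (auto simp: cring_real_scalars abelian_group_seq_space scale_carrier algebra_simps)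

sublocale real_normed_space E
proof -
  interpret module real_scalars E by (rule module_seq_space)
  show "real_normed_space E"
  proof
    fix x y c
    assume x: "x \<in> carrier E"
    show "nrm E x = 0 \<longleftrightarrow> x = \<zero>\<^bsub>E\<^esub>"
      using coordinate_le_nrm[OF x] by (auto simp: nrm_zero)
    show "nrm E (c \<odot>\<^bsub>E\<^esub> x) = \<bar>c\<bar> * nrm E x"
      using x by (simp add: nrm_scale)
    assume y: "y \<in> carrier E"
    show "nrm E (x \<oplus>\<^bsub>E\<^esub> y) \<le> nrm E x + nrm E y"
      using order_trans[OF triangle add_mono[OF p_le_nrm[OF x] p_le_nrm[OF y]]]
      by (auto intro!: nrm_le)
  qed
qed

lemma minus_eq:
  assumes "x \<in> carrier E" "y \<in> carrier E"
  shows "x \<ominus>\<^bsub>E\<^esub> y = (\<lambda>i. x i - y i)"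
proof -
  have "\<ominus>\<^bsub>E\<^esub> y = (\<lambda>i. - y i)"
    using smult_minus_one[OF assms(2)] by simp
  then show ?thesis
    by (simp add: a_minus_def)
qed

lemma minus_carrier:
  assumes "x \<in> carrier E" "y \<in> carrier E"
  shows "(\<lambda>i. x i - y i) \<in> carrier E"
  using minus_closed[OF assms] by (simp add: minus_eq assms)

text \<open>A Cauchy sequence has a coordinatewise limit \<open>g\<close>. Each Cauchy estimate is
  passed to the limit in one seminorm at a time, and only afterwards is the supremum over
  \<open>k\<close> taken.\<close>

lemma real_banach_space_seq_space: "real_banach_space E"
proof
  interpret Metric_space "carrier E" "nrm_dist E" by (rule Metric_space_nrm_dist)
  show "mcomplete"
    unfolding mcomplete_def
  proof (intro allI impI)
    fix s assume "MCauchy s"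
    then have s: "s n \<in> carrier E" for n
      by (auto simp: MCauchy_def)
    have cau: "\<exists>N. \<forall>m\<ge>N. \<forall>n\<ge>N. nrm E (\<lambda>i. s m i - s n i) < e" if "e > 0" for e
      using \<open>MCauchy s\<close> that s unfolding MCauchy_def nrm_dist_def by (simp add: minus_eq)
    have "Cauchy (\<lambda>n. s n i)" for i
    proof (rule metric_CauchyI)
      fix e :: real assume "e > 0"
      then obtain N where N: "\<forall>m\<ge>N. \<forall>n\<ge>N. nrm E (\<lambda>i. s m i - s n i) < e"
        using cau by blast
      have "dist (s m i) (s n i) < e" if "m \<ge> N" "n \<ge> N" for m n
        using N that coordinate_le_nrm[OF minus_carrier[OF s[of m] s[of n]], of i]
        by (fastforce simp: dist_real_def)
      then show "\<exists>N. \<forall>m\<ge>N. \<forall>n\<ge>N. dist (s m i) (s n i) < e"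
        by blast
    qed
    then have "\<exists>l. (\<lambda>n. s n i) \<longlonglongrightarrow> l" for i
      using Cauchy_convergent convergent_def by blast
    then obtain g where g: "(\<lambda>n. s n i) \<longlonglongrightarrow> g i" for i
      by metis
    \<comment> \<open>Let \<open>n\<close> tend to infinity with \<open>m\<close> and
      \<open>k\<close> fixed. Since \<open>N\<close> is chosen before \<open>k\<close>, the estimate
      is uniform in \<open>k\<close>; it yields both that \<open>g\<close> lies in the space and
      that the convergence is in norm.\<close>
    have close: "\<exists>N. \<forall>m\<ge>N. \<forall>k. p k (\<lambda>i. s m i - g i) \<le> e" if "e > 0" for e
    proof -
      obtain N where N: "\<forall>m\<ge>N. \<forall>n\<ge>N. nrm E (\<lambda>i. s m i - s n i) < e"
        using cau[OF \<open>e > 0\<close>] by blast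
      have "p k (\<lambda>i. s m i - g i) \<le> e" if "m \<ge> N" for m k
      proof (rule LIMSEQ_le_const2)
        show "(\<lambda>n. p k (\<lambda>i. s m i - s n i)) \<longlonglongrightarrow> p k (\<lambda>i. s m i - g i)"
          by (intro pointwise_continuous tendsto_intros g)
        show "\<exists>M. \<forall>n\<ge>M. p k (\<lambda>i. s m i - s n i) \<le> e"
          using N that p_le_nrm[OF minus_carrier[OF s s]] by (meson less_imp_le order_trans)
      qed
      then show ?thesis by blast
    qed
    have gE: "g \<in> carrier E"
    proof -
      \<comment> \<open>\<open>g\<close> is the difference of \<open>s N\<close> and
        \<open>s N - g\<close>, both of which lie in the space.\<close>
      obtain N where "\<forall>k. p k (\<lambda>i. s N i - g i) \<le> 1"
        using close[of 1] by auto
      then have "(\<lambda>i. s N i - g i) \<in> carrier E"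
        by (intro carrierI) auto
      then show ?thesis
        using minus_carrier[OF s[of N]] by fastforce
    qed
    have "limitin mtopology s g sequentially"
      unfolding limit_metric_sequentially
    proof (intro conjI allI impI gE)
      fix e :: real assume "e > 0"
      \<comment> \<open>The supremum only inherits a non-strict bound, so \<open>e / 2\<close> is
        used to end strictly below \<open>e\<close>.\<close>
      then obtain N where "\<forall>m\<ge>N. \<forall>k. p k (\<lambda>i. s m i - g i) \<le> e / 2"
        using close[of "e / 2"] by auto
      then have "\<forall>m\<ge>N. nrm E (\<lambda>i. s m i - g i) \<le> e / 2"
        using nrm_le by blast
      then show "\<exists>N. \<forall>n\<ge>N. s n \<in> carrier E \<and> nrm_dist E (s n) g < e"
        using \<open>e > 0\<close> s gE by (fastforce simp: nrm_dist_def minus_eq)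
    qed
    then show "\<exists>x. limitin mtopology s x sequentially" by blast
  qed
qed

end

section \<open>The spaces l1 and l2\<close>

interpretation l1: seminorm_sequence "\<lambda>k x. \<Sum>i<k. \<bar>x i\<bar>"
proof
  fix k i :: nat and c :: real and x y g :: "nat \<Rightarrow> real" and f :: "nat \<Rightarrow> nat \<Rightarrow> real"
  show "(\<Sum>i<k. \<bar>x i + y i\<bar>) \<le> (\<Sum>i<k. \<bar>x i\<bar>) + (\<Sum>i<k. \<bar>y i\<bar>)"
    by (simp add: sum.distrib[symmetric] sum_mono abs_triangle_ineq)
  show "(\<Sum>i<k. \<bar>c * x i\<bar>) = \<bar>c\<bar> * (\<Sum>i<k. \<bar>x i\<bar>)"
    by (simp add: abs_mult sum_distrib_left)
  show "\<bar>x i\<bar> \<le> (\<Sum>i<Suc i. \<bar>x i\<bar>)"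
    by (simp add: sum_nonneg)
  show "(\<lambda>n. \<Sum>i<k. \<bar>f n i\<bar>) \<longlonglongrightarrow> (\<Sum>i<k. \<bar>g i\<bar>)" if "\<And>i. (\<lambda>n. f n i) \<longlonglongrightarrow> g i"
    by (intro tendsto_intros that)
qed

interpretation l2: seminorm_sequence "\<lambda>k x. L2_set x {..<k}"
proof
  fix k i :: nat and c :: real and x y g :: "nat \<Rightarrow> real" and f :: "nat \<Rightarrow> nat \<Rightarrow> real"
  show "L2_set (\<lambda>i. x i + y i) {..<k} \<le> L2_set x {..<k} + L2_set y {..<k}"
    by (rule L2_set_triangle_ineq)
  show "L2_set (\<lambda>i. c * x i) {..<k} = \<bar>c\<bar> * L2_set x {..<k}"
    by (simp add: L2_set_def power_mult_distrib sum_distrib_left[symmetric] real_sqrt_mult)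
  show "\<bar>x i\<bar> \<le> L2_set x {..<Suc i}"
    \<comment> \<open>Replacing \<open>x\<close> by its absolute values leaves \<open>L2_set\<close>
      unchanged and gives the bound on the modulus of the coordinate.\<close>
    using member_le_L2_set[of "{..<Suc i}" i "\<lambda>i. \<bar>x i\<bar>"] by (simp add: L2_set_def)
  show "(\<lambda>n. L2_set (f n) {..<k}) \<longlonglongrightarrow> L2_set g {..<k}" if "\<And>i. (\<lambda>n. f n i) \<longlonglongrightarrow> g i"
    unfolding L2_set_def by (intro tendsto_intros that)
qed

text \<open>No partial sum exceeds the \<open>n\<close>-th one, so the supremum is reached there.
  This computes the norms of unit vectors and of signed sums of them.\<close>

lemma l1_finite_support:
  assumes "\<And>i. i \<ge> n \<Longrightarrow> x i = 0"
  shows "x \<in> carrier l1.E" and "nrm l1.E x = (\<Sum>i<n. \<bar>x i\<bar>)"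
proof -
  have le: "(\<Sum>i<k. \<bar>x i\<bar>) \<le> (\<Sum>i<n. \<bar>x i\<bar>)" for k
  proof -
    have "(\<Sum>i<k. \<bar>x i\<bar>) = (\<Sum>i\<in>{..<k} \<inter> {..<n}. \<bar>x i\<bar>)"
      using assms by (intro sum.mono_neutral_right) (auto simp: not_less[symmetric])
    also have "\<dots> \<le> (\<Sum>i<n. \<bar>x i\<bar>)"
      by (intro sum_mono2) auto
    finally show ?thesis .
  qed
  show x: "x \<in> carrier l1.E"
    by (rule l1.carrierI[OF le])
  show "nrm l1.E x = (\<Sum>i<n. \<bar>x i\<bar>)"
    using l1.nrm_le[OF le] l1.p_le_nrm[OF x, of n] by (rule antisym)
qed

text \<open>The identity holds exactly for the first \<open>k\<close> coordinates. Bounding its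
  right side by the full norms and letting \<open>k\<close> grow on the left gives this half of the
  parallelogram law, which is the half that the choice of signs uses.\<close>

lemma l2_parallelogram_le:
  assumes u: "u \<in> carrier l2.E" and v: "v \<in> carrier l2.E"
  shows "(nrm l2.E (\<lambda>i. u i + v i))\<^sup>2 + (nrm l2.E (\<lambda>i. u i - v i))\<^sup>2
    \<le> 2 * (nrm l2.E u)\<^sup>2 + 2 * (nrm l2.E v)\<^sup>2"
proof (rule LIMSEQ_le_const2)
  let ?p = "\<lambda>x k. L2_set x {..<k}"
  \<comment> \<open>Truncated norms increase with \<open>k\<close>, so their supremum is also their
    limit.\<close>
  have lim: "?p x \<longlonglongrightarrow> nrm l2.E x" if "x \<in> carrier l2.E" for x
  proof -
    have "incseq (?p x)"
      by (auto simp: incseq_def L2_set_def intro!: sum_mono2)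
    moreover have "bdd_above (range (?p x))"
      using that by (simp add: seq_space_def)
    ultimately show ?thesis
      using LIMSEQ_incseq_SUP[of "?p x"] by (simp add: seq_space_def)
  qed
  show "(\<lambda>k. (?p (\<lambda>i. u i + v i) k)\<^sup>2 + (?p (\<lambda>i. u i - v i) k)\<^sup>2)
      \<longlonglongrightarrow> (nrm l2.E (\<lambda>i. u i + v i))\<^sup>2 + (nrm l2.E (\<lambda>i. u i - v i))\<^sup>2"
    by (intro tendsto_intros lim l2.add_carrier l2.minus_carrier u v)
  have "(?p (\<lambda>i. u i + v i) k)\<^sup>2 + (?p (\<lambda>i. u i - v i) k)\<^sup>2 \<le> 2 * (nrm l2.E u)\<^sup>2 + 2 * (nrm l2.E v)\<^sup>2" for k
  proof -
    have "(?p (\<lambda>i. u i + v i) k)\<^sup>2 + (?p (\<lambda>i. u i - v i) k)\<^sup>2 = 2 * (?p u k)\<^sup>2 + 2 * (?p v k)\<^sup>2"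
      by (simp add: L2_set_def sum_nonneg sum_distrib_left sum.distrib[symmetric])
        (simp add: power2_eq_square algebra_simps)
    also have "\<dots> \<le> 2 * (nrm l2.E u)\<^sup>2 + 2 * (nrm l2.E v)\<^sup>2"
      using u v by (intro add_mono mult_left_mono power_mono l2.p_le_nrm) auto
    finally show ?thesis .
  qed
  then show "\<exists>N. \<forall>k\<ge>N. (?p (\<lambda>i. u i + v i) k)\<^sup>2 + (?p (\<lambda>i. u i - v i) k)\<^sup>2
      \<le> 2 * (nrm l2.E u)\<^sup>2 + 2 * (nrm l2.E v)\<^sup>2"
    by blast
qed

section \<open>Operators from l1 to l2\<close>

lemma bounded_operator_nonneg_bound:
  assumes "real_normed_space X" "T \<in> bounded_operators X Y"
  obtains C where "C \<ge> 0" "\<And>x. x \<in> carrier X \<Longrightarrow> nrm Y (T x) \<le> C * nrm X x"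
proof -
  obtain C where C: "\<And>x. x \<in> carrier X \<Longrightarrow> nrm Y (T x) \<le> C * nrm X x"
    using assms(2) unfolding bounded_operators_def by blast
  \<comment> \<open>Norms on \<open>X\<close> are nonnegative, so passing to
    \<open>\<bar>C\<bar>\<close> keeps the bound; the sign later allows
    \<open>sqrt (C\<^sup>2)\<close> to simplify to \<open>C\<close>.\<close>
  have "nrm Y (T x) \<le> \<bar>C\<bar> * nrm X x" if "x \<in> carrier X" for x
    using C[OF that] mult_right_mono[OF abs_ge_self[of C] real_normed_space.nrm_nonneg[OF assms(1) that]]
    by linarith
  then show ?thesis
    using that[of "\<bar>C\<bar>"] by simp
qed

text \<open>Induction on \<open>n\<close>: the next unit vector \<open>e\<close> is added or
  subtracted. By the parallelogram law the squared norms of the two images average at most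
  \<open>real n * C\<^sup>2 + C\<^sup>2\<close>, so one sign keeps the bound. The condition on
  \<open>\<bar>x i\<bar>\<close> encodes signs and support together.\<close>

lemma signed_sum_bound:
  assumes T: "T \<in> bounded_operators l1.E l2.E"
    and C: "C \<ge> 0" "\<And>x. x \<in> carrier l1.E \<Longrightarrow> nrm l2.E (T x) \<le> C * nrm l1.E x"
  shows "\<exists>x. (\<forall>i. \<bar>x i\<bar> = (if i < n then 1 else 0)) \<and> (nrm l2.E (T x))\<^sup>2 \<le> real n * C\<^sup>2"
proof (induction n)
  case 0
  have "nrm l2.E (T (\<lambda>i. 0)) = 0"
    using C(2)[OF l1.zero_carrier] l1.nrm_zero l2.nrm_nonneg[of "T (\<lambda>i. 0)"] T l1.zero_carrier
    by (auto simp: bounded_operators_def)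
  then show ?case
    by (intro exI[of _ "\<lambda>i. 0"]) auto
next
  case (Suc n)
  then obtain x where x: "\<And>i. \<bar>x i\<bar> = (if i < n then 1 else 0)"
    and Tx: "(nrm l2.E (T x))\<^sup>2 \<le> real n * C\<^sup>2"
    by blast
  define e :: "nat \<Rightarrow> real" where "e = (\<lambda>i. if i = n then 1 else 0)"
  have xE: "x \<in> carrier l1.E"
    by (rule l1_finite_support[of n]) (metis x abs_0_eq not_less)
  have eE: "e \<in> carrier l1.E" and "nrm l1.E e = 1"
    using l1_finite_support[of "Suc n" e] by (simp_all add: e_def)
  have add: "T (\<lambda>i. y i + z i) = (\<lambda>i. T y i + T z i)"
    if "y \<in> carrier l1.E" "z \<in> carrier l1.E" for y z
    using T that by (simp add: bounded_operators_def)
  have scale: "T (\<lambda>i. c * y i) = (\<lambda>i. c * T y i)" if "y \<in> carrier l1.E" for c y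
    using T that by (simp add: bounded_operators_def)
  \<comment> \<open>Linearity is given through sums and scalar multiples, so the difference is first
    written in these terms.\<close>
  have "T (\<lambda>i. x i + - 1 * e i) = (\<lambda>i. T x i + - 1 * T e i)"
    using add[OF xE l1.scale_carrier[OF eE, of "- 1"]] scale[OF eE, of "- 1"] by simp
  then have minus: "T (\<lambda>i. x i - e i) = (\<lambda>i. T x i - T e i)"
    by simp
  have TE: "T x \<in> carrier l2.E" "T e \<in> carrier l2.E"
    using T xE eE by (auto simp: bounded_operators_def)
  have "nrm l2.E (T e) \<le> C"
    using C(2)[OF eE] \<open>nrm l1.E e = 1\<close> by simp
  then have "(nrm l2.E (T e))\<^sup>2 \<le> C\<^sup>2"
    using l2.nrm_nonneg[OF TE(2)] by (intro power_mono)
  then have "2 * (nrm l2.E (T x))\<^sup>2 + 2 * (nrm l2.E (T e))\<^sup>2 \<le> 2 * (real (Suc n) * C\<^sup>2)"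
    using Tx by (simp add: distrib_right)
  then have "(nrm l2.E (T (\<lambda>i. x i + e i)))\<^sup>2 + (nrm l2.E (T (\<lambda>i. x i - e i)))\<^sup>2
      \<le> 2 * (real (Suc n) * C\<^sup>2)"
    unfolding add[OF xE eE] minus by (rule order_trans[OF l2_parallelogram_le[OF TE]])
  \<comment> \<open>Two numbers with sum at most twice a bound cannot both exceed it; the smaller
    one decides the sign.\<close>
  then consider (1) "(nrm l2.E (T (\<lambda>i. x i + e i)))\<^sup>2 \<le> real (Suc n) * C\<^sup>2"
    | (2) "(nrm l2.E (T (\<lambda>i. x i - e i)))\<^sup>2 \<le> real (Suc n) * C\<^sup>2"
    by linarith
  moreover have signs: "\<bar>x i + e i\<bar> = (if i < Suc n then 1 else 0)"
    "\<bar>x i - e i\<bar> = (if i < Suc n then 1 else 0)" for i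
    using x[of i] by (auto simp: e_def less_Suc_eq)
  ultimately show ?case
  proof cases
    case 1
    with signs(1) show ?thesis
      by (intro exI[of _ "\<lambda>i. x i + e i"]) simp
  next
    case 2
    with signs(2) show ?thesis
      by (intro exI[of _ "\<lambda>i. x i - e i"]) simp
  qed
qed

text \<open>A signed sum of \<open>Suc n\<close> unit vectors has l1-norm \<open>Suc n\<close> but
  an image of norm at most \<open>C * sqrt (Suc n)\<close>; normalizing it gives unit vectors whose
  images tend to 0.\<close>

lemma min_modulus_l1_l2:
  assumes T: "T \<in> bounded_operators l1.E l2.E"
  shows "min_modulus l1.E l2.E T = 0"
proof (rule antisym)
  show "0 \<le> min_modulus l1.E l2.E T"
    using T unfolding min_modulus_def
    by (intro INF_greatest) (auto simp: unit_sphere_def bounded_operators_def intro!: l2.nrm_nonneg)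
  obtain C where C: "C \<ge> 0" "\<And>x. x \<in> carrier l1.E \<Longrightarrow> nrm l2.E (T x) \<le> C * nrm l1.E x"
    using bounded_operator_nonneg_bound[OF l1.real_normed_space_axioms T] by blast
  have le: "min_modulus l1.E l2.E T \<le> ereal (C / sqrt (real (Suc n)))" for n
  proof -
    obtain x where x: "\<And>i. \<bar>x i\<bar> = (if i < Suc n then 1 else 0)"
      and Tx: "(nrm l2.E (T x))\<^sup>2 \<le> real (Suc n) * C\<^sup>2"
      using signed_sum_bound[OF T C] by blast
    have x0: "x i = 0" if "i \<ge> Suc n" for i
      using x[of i] that by simp
    have xE: "x \<in> carrier l1.E" and nx: "nrm l1.E x = real (Suc n)"
      using l1_finite_support[of "Suc n" x, OF x0] by (simp_all add: x del: sum.lessThan_Suc)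
    \<comment> \<open>The factor is the inverse of the l1-norm of \<open>x\<close>; counting from
      \<open>Suc n\<close> keeps that norm positive.\<close>
    let ?c = "1 / real (Suc n)"
    let ?y = "\<lambda>i. ?c * x i"
    have y: "?y \<in> unit_sphere l1.E"
      unfolding unit_sphere_def
      using l1.scale_carrier[OF xE, of ?c] l1.nrm_scale[OF xE, of ?c] nx by simp
    have TxE: "T x \<in> carrier l2.E" and "T (\<lambda>i. c * x i) = (\<lambda>i. c * T x i)" for c
      using T xE by (auto simp: bounded_operators_def)
    then have "nrm l2.E (T ?y) = nrm l2.E (T x) / real (Suc n)"
      by (simp only: l2.nrm_scale) simp
    also have "\<dots> \<le> (sqrt (real (Suc n)) * C) / real (Suc n)"
    proof (rule divide_right_mono)
      have "nrm l2.E (T x) \<le> sqrt (real (Suc n) * C\<^sup>2)"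
        using Tx by (rule real_le_rsqrt)
      then show "nrm l2.E (T x) \<le> sqrt (real (Suc n)) * C"
        using C(1) by (simp add: real_sqrt_mult)
    qed simp
    also have "\<dots> = C / sqrt (real (Suc n))"
      by (simp add: field_simps flip: power2_eq_square)
    finally show ?thesis
      unfolding min_modulus_def using y by (intro INF_lower2[of ?y]) auto
  qed
  have "(\<lambda>n. C / sqrt (real (Suc n))) \<longlonglongrightarrow> 0"
    by (intro real_tendsto_divide_at_top[OF tendsto_const] filterlim_compose[OF sqrt_at_top]
        filterlim_compose[OF filterlim_real_sequentially] filterlim_Suc)
  then have "(\<lambda>n. ereal (C / sqrt (real (Suc n)))) \<longlonglongrightarrow> ereal 0"
    by simp
  then show "min_modulus l1.E l2.E T \<le> 0"
    unfolding zero_ereal_def by (rule LIMSEQ_le_const) (use le in blast)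
qed

section \<open>The compact perturbation property for the pair l1, l2\<close>

text \<open>Points are closed in a metric topology. The zero operator sends the unit ball to this
  singleton, and compactness of an operator concerns the closure of that image.\<close>

lemma (in real_normed_space) closure_of_zero:
  "nrm_topology X closure_of {\<zero>} = {\<zero>}"
proof -
  interpret Metric_space "carrier X" "nrm_dist X" by (rule Metric_space_nrm_dist)
  show ?thesis
    using closedin_Hausdorff_sing_eq[OF Hausdorff_space_mtopology, of \<zero>]
    by (simp add: closure_of_eq)
qed

text \<open>This shows that the family of compact perturbations is nonempty; over an empty family
  the supremum in the extended reals would be minus infinity instead of 0.\<close>

lemma zero_compact_l1_l2: "(\<lambda>x i. 0) \<in> compact_operators l1.E l2.E"
proof -
  have "(\<lambda>x i. 0) \<in> bounded_operators l1.E l2.E"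
    by (auto simp: bounded_operators_def l2.zero_carrier l2.nrm_zero intro!: exI[of _ 0])
  moreover have "(\<lambda>x i. 0) ` {x \<in> carrier l1.E. nrm l1.E x \<le> 1} = {\<zero>\<^bsub>l2.E\<^esub>}"
    using l1.zero_carrier l1.nrm_zero by (auto simp: image_iff)
  moreover have "compactin (nrm_topology l2.E) {\<zero>\<^bsub>l2.E\<^esub>}"
    using l2.zero_carrier Metric_space.topspace_mtopology[OF l2.Metric_space_nrm_dist]
    by (simp add: finite_imp_compactin)
  ultimately show ?thesis
    by (simp add: compact_operators_def l2.closure_of_zero del: seq_space_simps)
qed

lemma bounded_operators_l1_l2_add:
  assumes T: "T \<in> bounded_operators l1.E l2.E" and K: "K \<in> bounded_operators l1.E l2.E"
  shows "(\<lambda>x. T x \<oplus>\<^bsub>l2.E\<^esub> K x) \<in> bounded_operators l1.E l2.E"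
proof -
  obtain C where C: "\<And>x. x \<in> carrier l1.E \<Longrightarrow> nrm l2.E (T x) \<le> C * nrm l1.E x"
    using T unfolding bounded_operators_def by blast
  obtain D where D: "\<And>x. x \<in> carrier l1.E \<Longrightarrow> nrm l2.E (K x) \<le> D * nrm l1.E x"
    using K unfolding bounded_operators_def by blast
  have TK: "T x \<in> carrier l2.E" "K x \<in> carrier l2.E" if "x \<in> carrier l1.E" for x
    using T K that by (auto simp: bounded_operators_def)
  have "nrm l2.E (T x \<oplus>\<^bsub>l2.E\<^esub> K x) \<le> (C + D) * nrm l1.E x" if "x \<in> carrier l1.E" for x
    using l2.nrm_triangle[OF TK[OF that]] C[OF that] D[OF that] by (simp add: distrib_right)
  then have "\<exists>B. \<forall>x\<in>carrier l1.E. nrm l2.E (T x \<oplus>\<^bsub>l2.E\<^esub> K x) \<le> B * nrm l1.E x"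
    by blast
  with T K TK show ?thesis
    by (auto simp: bounded_operators_def l2.add_carrier algebra_simps)
qed

text \<open>Each \<open>T + K\<close> is itself a bounded operator from l1 to l2, so both sides of
  the required equation are 0.\<close>

lemma cppm_l1_l2: "compact_perturbation_property_min l1.E l2.E"
  unfolding compact_perturbation_property_min_def
proof (intro ballI impI)
  fix T assume T: "T \<in> bounded_operators l1.E l2.E"
  have "min_modulus l1.E l2.E (\<lambda>x. T x \<oplus>\<^bsub>l2.E\<^esub> K x) = 0" if "K \<in> compact_operators l1.E l2.E" for K
    using bounded_operators_l1_l2_add[OF T, of K] that
    by (intro min_modulus_l1_l2) (auto simp: compact_operators_def)
  then have "(SUP K\<in>compact_operators l1.E l2.E. min_modulus l1.E l2.E (\<lambda>x. T x \<oplus>\<^bsub>l2.E\<^esub> K x))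
      = (SUP K\<in>compact_operators l1.E l2.E. 0)"
    by (intro SUP_cong) auto
  then show "(SUP K\<in>compact_operators l1.E l2.E. min_modulus l1.E l2.E (\<lambda>x. T x \<oplus>\<^bsub>l2.E\<^esub> K x))
      = min_modulus l1.E l2.E T"
    using zero_compact_l1_l2 min_modulus_l1_l2[OF T] by (auto simp: SUP_constant)
qed

section \<open>Failure of the weak minimizing property\<close>

text \<open>Summation takes the value 1 at every unit vector, so it is the functional that keeps the
  unit vectors of l1 from being weakly null. It is linear and bounded on l1 because the series there
  converge absolutely.\<close>

lemma sum_functional_bounded: "suminf \<in> bounded_operators l1.E real_line"
proof -
  have sm: "summable (\<lambda>i. \<bar>x i\<bar>)" if "x \<in> carrier l1.E" for x
    using l1.p_le_nrm[OF that] by (intro summableI_nonneg_bounded) auto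
  have "\<bar>suminf x\<bar> \<le> nrm l1.E x" if "x \<in> carrier l1.E" for x
    using summable_rabs[OF sm[OF that]] suminf_le_const[OF sm[OF that] l1.p_le_nrm[OF that]]
    by linarith
  then show ?thesis
    using summable_rabs_cancel[OF sm]
    by (auto simp: bounded_operators_def real_line_def suminf_add suminf_mult
        intro!: exI[of _ 1])
qed

lemma not_wmp_l1_l2: "\<not> weak_minimizing_property l1.E l2.E"
proof
  assume wmp: "weak_minimizing_property l1.E l2.E"
  \<comment> \<open>The weights are nonzero, which makes \<open>T\<close> injective, and tend to 0,
    which makes the unit vectors minimizing. \<open>Suc\<close> avoids a division by zero at index
    0.\<close>
  define T :: "(nat \<Rightarrow> real) \<Rightarrow> nat \<Rightarrow> real" where "T = (\<lambda>x i. x i / real (Suc i))"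
  define e :: "nat \<Rightarrow> nat \<Rightarrow> real" where "e = (\<lambda>n i. if i = n then 1 else 0)"
  \<comment> \<open>The weights are at most 1 and the Euclidean norm is at most the sum of moduli,
    so \<open>T\<close> maps l1 into l2 with constant 1.\<close>
  have T_le: "L2_set (T x) {..<k} \<le> nrm l1.E x" if "x \<in> carrier l1.E" for x k
  proof -
    have "L2_set (T x) {..<k} \<le> (\<Sum>i<k. \<bar>T x i\<bar>)"
      by (rule L2_set_le_sum_abs)
    also have "\<dots> \<le> (\<Sum>i<k. \<bar>x i\<bar>)"
      by (intro sum_mono) (simp add: T_def divide_le_eq mult_left_le algebra_simps)
    also have "\<dots> \<le> nrm l1.E x"
      by (rule l1.p_le_nrm[OF that])
    finally show ?thesis .
  qed
  have T: "T \<in> bounded_operators l1.E l2.E"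
    unfolding bounded_operators_def
    using l2.carrierI[OF T_le] l2.nrm_le[OF T_le]
    by (auto simp: T_def add_divide_distrib intro!: exI[of _ 1])
  have e: "e n \<in> unit_sphere l1.E" for n
    using l1_finite_support[of "Suc n" "e n"] by (simp add: unit_sphere_def e_def)
  then have eE: "e n \<in> carrier l1.E" for n
    by (simp add: unit_sphere_def)
  have "nrm l2.E (T (e n)) = 1 / real (Suc n)" for n
  proof -
    \<comment> \<open>\<open>e n\<close> is an eigenvector of \<open>T\<close>, so it remains to see
      that it has norm 1 in l2: the truncations give the upper bound, coordinate \<open>n\<close>
      the lower one.\<close>
    have "T (e n) = (\<lambda>i. (1 / real (Suc n)) * e n i)"
      by (auto simp: T_def e_def)
    moreover have "e n \<in> carrier l2.E \<and> nrm l2.E (e n) = 1"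
    proof -
      have le: "L2_set (e n) {..<k} \<le> 1" for k
        by (simp add: L2_set_def e_def if_distrib[of "\<lambda>x. x\<^sup>2"] cong: if_cong)
      show ?thesis
        using l2.carrierI[OF le] l2.nrm_le[OF le] l2.coordinate_le_nrm[of "e n" n]
        by (auto simp: e_def)
    qed
    ultimately show ?thesis
      using l2.nrm_scale[of "e n" "1 / real (Suc n)"] by simp
  qed
  moreover have "(\<lambda>n. 1 / real (Suc n)) \<longlonglongrightarrow> 0"
    using LIMSEQ_inverse_real_of_nat by (simp add: inverse_eq_divide)
  ultimately have "(\<lambda>n. ereal (nrm l2.E (T (e n)))) \<longlonglongrightarrow> ereal 0"
    by simp
  then have "minimizing_sequence l1.E l2.E T e"
    using e by (simp add: minimizing_sequence_def min_modulus_l1_l2[OF T] zero_ereal_def)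
  moreover have "\<not> weakly_null l1.E e"
  proof
    assume "weakly_null l1.E e"
    then have "(\<lambda>n. suminf (e n)) \<longlonglongrightarrow> 0"
      using sum_functional_bounded by (auto simp: weakly_null_def)
    moreover have "suminf (e n) = 1" for n
      using suminf_finite[of "{n}" "e n"] by (simp add: e_def)
    ultimately show False
      by (simp add: LIMSEQ_const_iff)
  qed
  ultimately have "attains_min_modulus l1.E l2.E T"
    using wmp T by (auto simp: weak_minimizing_property_def)
  \<comment> \<open>Attainment would give a unit vector with \<open>T x\<close> of norm 0, hence in
    the kernel of \<open>T\<close>, contradicting injectivity.\<close>
  then obtain x where x: "x \<in> carrier l1.E" "nrm l1.E x = 1" and "nrm l2.E (T x) = 0"
    by (auto simp: attains_min_modulus_def unit_sphere_def min_modulus_l1_l2[OF T])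
  moreover have "T x \<in> carrier l2.E"
    using T x by (auto simp: bounded_operators_def)
  ultimately have "T x = (\<lambda>i. 0)"
    using l2.nrm_eq_zero_iff by simp
  then have "x = (\<lambda>i. 0)"
    by (auto simp: T_def fun_eq_iff)
  with x show False
    by (simp add: l1.nrm_zero)
qed

theorem mainTheorem7:
  shows "\<exists>(X :: (nat \<Rightarrow> real) normed_space) (Y :: (nat \<Rightarrow> real) normed_space).
    real_banach_space X \<and> real_banach_space Y \<and>
    compact_perturbation_property_min X Y \<and> \<not> weak_minimizing_property X Y"
  using l1.real_banach_space_seq_space l2.real_banach_space_seq_space cppm_l1_l2 not_wmp_l1_l2
  by blast

end
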